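(* Let $\mathcal{X}$ and $\mathcal{Y}$ be measurable spaces, let $\mu$ be a probability measure on $\mathcal{X}$ and $\nu$ a probability measure on $\mathcal{Y}$. Suppose that $p:\mathcal{X}\times\mathcal{Y}\to(0,\infty)$ is jointly measurable and positive everywhere, and that there exists a measurable positive function $U:\mathcal{X}\to(0,\infty)$ such that: (i) $\Psi[U](y):=\int_{\mathcal{X}}p(x',y)U(x')^{-1}\,\mu(dx')<\infty$ for all $y\in\mathcal{Y}$; (ii) $\Phi[U](x):=\int_{\mathcal{Y}}p(x,y)\Psi[U](y)^{-1}\,\nu(dy)<\infty$ for all $x\in\mathcal{X}$; (iii) for any $x_o\in\mathcal{X}$ there exist two real numbers $r>1$, $c>0$ such that $$\int_{\mathcal{Y}}\left(\frac{p(x,y)}{p(x_o,y)}\right)^{r}p(x_o,y)\,\Psi[U](y)^{-1}\,\nu(dy)\le c\,U(x)^r,\qquad\forall x\in\mathcal{X}.$$ Then the Schrödinger system $$\mathsf{a}(dx)\int_{\mathcal{Y}}p(x,y)\,\mathsf{b}(dy)=\mu(dx),\qquad \mathsf{b}(dy)\int_{\mathcal{X}}p(x,y)\,\mathsf{a}(dx)=\nu(dy)$$ admits a unique solution $(\mathsf{a},\mathsf{b})$, uniqueness being understood up to the transformations $(\mathsf{a},\mathsf{b})\mapsto(\kappa^{-1}\mathsf{a},\kappa\mathsf{b})$, $\kappa>0$.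
   Context: A solution of the Schrödinger system is a pair $(\mathsf{a},\mathsf{b})$ where $\mathsf{a}$ is a $\sigma$-finite nonnegative measure on $\mathcal{X}$ and $\mathsf{b}$ is a $\sigma$-finite nonnegative measure on $\mathcal{Y}$ satisfying the two displayed identities between measures (on $\mathcal{X}$ and on $\mathcal{Y}$ respectively). *)

theory Defs
  imports "HOL-Analysis.Analysis" "HOL-Probability.Probability"
begin

text \<open>
  The measurable spaces X and Y are those underlying the probability measures \<open>\<mu>\<close> and \<open>\<nu>\<close>,
  i.e. \<open>(space \<mu>, sets \<mu>)\<close> and \<open>(space \<nu>, sets \<nu>)\<close>. Integrals are taken in \<^typ>\<open>ennreal\<close>, so
  that their finiteness is a genuine condition.
\<close>

definition schroedinger_Psi ::
    "'a measure \<Rightarrow> ('a \<times> 'b \<Rightarrow> real) \<Rightarrow> ('a \<Rightarrow> real) \<Rightarrow> 'b \<Rightarrow> ennreal" where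
  "schroedinger_Psi \<mu> p U y = (\<integral>\<^sup>+ x'. ennreal (p (x', y) * inverse (U x')) \<partial>\<mu>)"

definition schroedinger_Phi ::
    "'a measure \<Rightarrow> 'b measure \<Rightarrow> ('a \<times> 'b \<Rightarrow> real) \<Rightarrow> ('a \<Rightarrow> real) \<Rightarrow> 'a \<Rightarrow> ennreal" where
  "schroedinger_Phi \<mu> \<nu> p U x =
     (\<integral>\<^sup>+ y. ennreal (p (x, y)) * inverse (schroedinger_Psi \<mu> p U y) \<partial>\<nu>)"

text \<open>
  The conditions on \<^const>\<open>sets\<close> say that \<open>a\<close> and \<open>b\<close> live on the measurable spaces X and Y.
  Sigma-finiteness of \<open>a\<close> and \<open>b\<close> makes both densities measurable whenever \<open>p\<close> is jointly
  measurable, so \<^const>\<open>density\<close> has its intended meaning.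
\<close>

definition schroedinger_solution ::
    "'a measure \<Rightarrow> 'b measure \<Rightarrow> ('a \<times> 'b \<Rightarrow> real) \<Rightarrow> 'a measure \<Rightarrow> 'b measure \<Rightarrow> bool" where
  "schroedinger_solution \<mu> \<nu> p a b \<longleftrightarrow>
     sets a = sets \<mu> \<and> sigma_finite_measure a \<and>
     sets b = sets \<nu> \<and> sigma_finite_measure b \<and>
     density a (\<lambda>x. \<integral>\<^sup>+ y. ennreal (p (x, y)) \<partial>b) = \<mu> \<and>
     density b (\<lambda>y. \<integral>\<^sup>+ x. ennreal (p (x, y)) \<partial>a) = \<nu>"

end

theory Submission
  imports Defs
begin

text \<open>
  Write \<open>K f y = \<integral> k x y / f x d\<mu>\<close> and let \<open>T = K' \<circ> K\<close>, where \<open>K'\<close> is the same operator for the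
  transposed kernel and \<open>\<nu>\<close>. Solutions of the system are \<open>a = \<mu> / f\<close>, \<open>b = \<nu> / K f\<close> with \<open>T f = f\<close>
  almost everywhere. The operator \<open>T\<close> is monotone and 1-homogeneous, and by Tonelli
  \<open>\<integral> T f / f d\<mu> = \<nu> {0 < K f < \<infinity>}\<close>; hence a supersolution (with \<open>K f\<close> finite) or a subsolution
  is already a fixed point.

  Existence: put \<open>F 0 = U\<close>, \<open>F (n + 1) = min U (T (F n))\<close>, a decreasing sequence. If \<open>T (F n) x\<^sub>o\<close>
  stays away from 0, the limit of \<open>F\<close> is a positive subsolution. Otherwise condition (iii) forces
  \<open>T (F n) \<le> U\<close> everywhere for some \<open>n\<close>, so that \<open>T (F n) = F (n + 1) \<le> F n\<close> and \<open>F n\<close> is a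
  supersolution.

  Uniqueness: if \<open>f\<close> and \<open>g\<close> are fixed points then \<open>min f g\<close> is a supersolution, hence a fixed point,
  and equality in the monotonicity estimates forces \<open>min f g\<close> to be \<open>f\<close> or \<open>g\<close>. Applied to \<open>g\<close> and
  all multiples of \<open>f\<close>, this makes \<open>g / f\<close> constant.
\<close>

section \<open>Extended nonnegative reals, integrals and densities\<close>

lemma ennreal_inverse_antimono:
  fixes a b :: ennreal
  assumes "a \<le> b"
  shows "inverse b \<le> inverse a"
proof (cases "a = 0 \<or> b = \<top>")
  case False
  with assms show ?thesis
    by (cases a; cases b) (auto simp: inverse_ennreal le_imp_inverse_le top_unique)
qed auto

lemma ennreal_inverse_inverse: "inverse (inverse a) = (a :: ennreal)"
proof (cases "a = 0 \<or> a = \<top>")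
  case False
  then show ?thesis
    by (cases a) (auto simp: inverse_ennreal)
qed auto

lemma ennreal_inverse_le_inverse_iff:
  "inverse a \<le> inverse b \<longleftrightarrow> b \<le> (a :: ennreal)"
  by (metis ennreal_inverse_antimono ennreal_inverse_inverse)

lemma ennreal_inverse_INF:
  fixes f :: "'i \<Rightarrow> ennreal"
  shows "inverse (INF i\<in>I. f i) = (SUP i\<in>I. inverse (f i))"
proof (rule antisym)
  show "(SUP i\<in>I. inverse (f i)) \<le> inverse (INF i\<in>I. f i)"
    by (intro SUP_least ennreal_inverse_antimono INF_lower)
  have "inverse (SUP i\<in>I. inverse (f i)) \<le> (INF i\<in>I. f i)"
    by (intro INF_greatest) (metis SUP_upper ennreal_inverse_antimono ennreal_inverse_inverse)
  then show "inverse (INF i\<in>I. f i) \<le> (SUP i\<in>I. inverse (f i))"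
    by (metis ennreal_inverse_antimono ennreal_inverse_inverse)
qed

lemma ennreal_inverse_SUP:
  fixes f :: "'i \<Rightarrow> ennreal"
  shows "inverse (SUP i\<in>I. f i) = (INF i\<in>I. inverse (f i))"
proof -
  have "inverse (INF i\<in>I. inverse (f i)) = (SUP i\<in>I. f i)"
    by (simp add: ennreal_inverse_INF ennreal_inverse_inverse)
  then show ?thesis
    by (metis ennreal_inverse_inverse)
qed

lemma ennreal_inverse_min:
  "inverse (min a b) = max (inverse a) (inverse b :: ennreal)"
  by (cases a b rule: linorder_cases)
     (auto simp: min_def max_def ennreal_inverse_le_inverse_iff)

lemma ennreal_mult_inverse_cancel:
  fixes a :: ennreal
  assumes "0 < a" "a < \<top>"
  shows "a * inverse a = 1" "inverse a * a = 1"
  using ennreal_mult_divide_eq[of a 1] assms by (auto simp: divide_ennreal_def mult.commute)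

text \<open>Inversion is an order-reversing involution, so this reduces to the distribution of
  multiplication over suprema. The bounds on \<open>c\<close> keep the product out of the
  indeterminate case 0 times \<top>.\<close>

lemma ennreal_INF_mult_left:
  fixes c :: ennreal
  assumes "0 < c" "c < \<top>"
  shows "c * (INF i\<in>I. f i) = (INF i\<in>I. c * f i)"
proof -
  have *: "c * inverse a = inverse (inverse c * a)" for a
    using assms by (subst ennreal_inverse_mult')
      (auto simp: ennreal_inverse_inverse less_top[symmetric] zero_less_iff_neq_zero)
  have "c * (INF i\<in>I. f i) = c * inverse (SUP i\<in>I. inverse (f i))"
    by (simp add: ennreal_inverse_SUP ennreal_inverse_inverse)
  also have "\<dots> = (INF i\<in>I. inverse (inverse c * inverse (f i)))"
    by (simp only: * SUP_mult_left_ennreal) (simp only: ennreal_inverse_SUP)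
  also have "\<dots> = (INF i\<in>I. c * f i)"
    by (simp add: *[symmetric] ennreal_inverse_inverse)
  finally show ?thesis .
qed

lemma ennreal_mult_inverse_le_1: "(a :: ennreal) * inverse a \<le> 1"
  by (cases "a = 0 \<or> a = \<top>") (auto simp: ennreal_mult_inverse_cancel less_top zero_less_iff_neq_zero)

text \<open>The difference \<open>g - f\<close> has integral 0; finiteness of the integrals permits
  the subtraction. Every equality case below goes back to this fact.\<close>

lemma nn_integral_mono_eq_imp_AE_eq:
  fixes f g :: "'a \<Rightarrow> ennreal"
  assumes [measurable]: "f \<in> borel_measurable M" "g \<in> borel_measurable M"
    and le: "AE x in M. f x \<le> g x"
    and int: "integral\<^sup>N M g \<le> integral\<^sup>N M f" and fin: "integral\<^sup>N M g < \<top>"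
  shows "AE x in M. f x = g x"
proof -
  have fin_f: "integral\<^sup>N M f \<noteq> \<infinity>"
    using nn_integral_mono_AE[OF le] fin by (auto simp: less_top)
  have "(\<integral>\<^sup>+x. g x - f x \<partial>M) = integral\<^sup>N M g - integral\<^sup>N M f"
    by (rule nn_integral_diff) (use fin_f le in auto)
  also have "\<dots> = 0"
    using int fin by (simp add: diff_eq_0_iff_ennreal)
  finally have "AE x in M. g x - f x = 0"
    by (subst (asm) nn_integral_0_iff_AE) auto
  moreover have "AE x in M. f x \<noteq> \<infinity>"
    by (rule nn_integral_noteq_infinite) (use fin_f in auto)
  ultimately show ?thesis
    using le by eventually_elim (auto simp: diff_eq_0_iff_ennreal less_top)
qed

text \<open>The constant is the infimum of the almost sure upper bounds of \<open>u\<close>: by the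
  dichotomy, every number below it is an almost sure lower bound. Nontriviality of the filter makes
  this infimum a real number.\<close>

lemma AE_eq_const_of_AE_linear:
  fixes u :: "'a \<Rightarrow> real"
  assumes nontriv: "ae_filter M \<noteq> bot"
    and dich: "\<And>l. (AE x in M. u x \<le> l) \<or> (AE x in M. l \<le> u x)"
  shows "\<exists>c. AE x in M. u x = c"
proof -
  let ?S = "{l. AE x in M. u x \<le> l}"
  have ne: "?S \<noteq> {}"
  proof
    assume "?S = {}"
    with dich have "AE x in M. real n \<le> u x" for n by blast
    then have "AE x in M. \<forall>n. real n \<le> u x" by (simp add: AE_all_countable)
    then have "AE x in M. False" 
      by eventually_elim (metis reals_Archimedean2 not_le)
    with nontriv show False by (simp add: trivial_limit_def)
  qed
  have bdd: "bdd_below ?S"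
  proof (rule ccontr)
    assume *: "\<not> bdd_below ?S"
    have "AE x in M. u x \<le> - real n" for n
    proof -
      obtain l where "AE x in M. u x \<le> l" "l < - real n"
        using * by (auto simp: bdd_below_def not_le)
      then show ?thesis by (auto elim!: eventually_mono)
    qed
    then have "AE x in M. \<forall>n. u x \<le> - real n" by (simp add: AE_all_countable)
    then have "AE x in M. False"
      by eventually_elim (metis reals_Archimedean2 not_le le_minus_iff)
    with nontriv show False by (simp add: trivial_limit_def)
  qed
  have "AE x in M. u x \<le> Inf ?S + 1 / real (Suc n)" for n
  proof -
    obtain l where "l \<in> ?S" "l < Inf ?S + 1 / real (Suc n)"
      using cInf_lessD[OF ne, of "Inf ?S + 1 / real (Suc n)"] by auto
    then show ?thesis by (auto elim!: eventually_mono)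
  qed
  moreover have "AE x in M. Inf ?S - 1 / real (Suc n) \<le> u x" for n
  proof -
    have "Inf ?S - 1 / real (Suc n) \<notin> ?S"
      using cInf_lower[OF _ bdd, of "Inf ?S - 1 / real (Suc n)"]
      by (auto simp: field_simps)
    with dich show ?thesis by blast
  qed
  ultimately have "AE x in M. \<forall>n. \<bar>u x - Inf ?S\<bar> \<le> 1 / real (Suc n)"
    by (simp add: AE_all_countable abs_le_iff algebra_simps)
  then have "AE x in M. u x = Inf ?S"
  proof eventually_elim
    case (elim x)
    then have "\<bar>u x - Inf ?S\<bar> \<le> 0"
      by (intro LIMSEQ_le_const[OF LIMSEQ_inverse_real_of_nat]) (auto simp: divide_inverse)
    then show ?case by simp
  qed
  then show ?thesis ..
qed

text \<open>Total mass 1 makes \<open>f\<close> integrable, hence finite almost everywhere; being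
  also positive, it can be divided out. This recovers an unknown measure from its equation in the
  system.\<close>

lemma density_eq_prob_imp_eq_density_inverse:
  assumes M: "prob_space M" and eq: "density a f = M"
    and [measurable]: "f \<in> borel_measurable a" and pos: "\<And>x. x \<in> space a \<Longrightarrow> 0 < f x"
  shows "AE x in M. f x < \<top>" "a = density M (\<lambda>x. inverse (f x))"
proof -
  have "(\<integral>\<^sup>+x. f x \<partial>a) = emeasure (density a f) (space a)"
    by (auto simp: emeasure_density intro!: nn_integral_cong)
  also have "\<dots> = 1"
    using prob_space.emeasure_space_1[OF M] eq by auto
  finally have fin: "AE x in a. f x \<noteq> \<infinity>"
    by (intro nn_integral_noteq_infinite) auto
  then have "AE x in density a f. f x < \<top>"
    by (subst AE_density) (auto elim!: eventually_mono simp: less_top[symmetric])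
  then show "AE x in M. f x < \<top>" unfolding eq .
  have "density M (\<lambda>x. inverse (f x)) = density a (\<lambda>x. f x * inverse (f x))"
    unfolding eq[symmetric] by (rule density_density_eq) auto
  also have "\<dots> = density a (\<lambda>_. 1)"
  proof (rule density_cong)
    show "AE x in a. f x * inverse (f x) = 1"
      using fin AE_space
      by eventually_elim (auto simp: pos less_top[symmetric] ennreal_mult_inverse_cancel)
  qed auto
  finally show "a = density M (\<lambda>x. inverse (f x))" by (simp add: density_1)
qed

lemma density_cong_space:
  "(\<And>x. x \<in> space M \<Longrightarrow> f x = g x) \<Longrightarrow> density M f = density M g"
  unfolding density_def by (auto intro!: measure_of_eq nn_integral_cong sets.space_closed)

lemma scale_measure_density:
  assumes [measurable]: "f \<in> borel_measurable M"
  shows "scale_measure c (density M f) = density M (\<lambda>x. c * f x)"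
  by (intro measure_eqI) (auto simp: emeasure_density nn_integral_cmult[symmetric] mult.assoc)

text \<open>The exponent \<open>1 - r\<close> is nonpositive, so \<open>s powr (1 - r)\<close> can
  only grow when \<open>s\<close> is lowered to \<open>t\<close>. Above a truncation level, this
  trades a first power for an \<open>r\<close>-th power.\<close>

lemma le_powr_mult_powr:
  fixes s t r :: real
  assumes "0 < t" "t \<le> s" "1 \<le> r"
  shows "s \<le> t powr (1 - r) * s powr r"
proof -
  have "s = s powr (1 - r) * s powr r"
    using assms by (simp add: powr_add[symmetric])
  also have "\<dots> \<le> t powr (1 - r) * s powr r"
    using assms by (intro mult_right_mono powr_mono2') auto
  finally show ?thesis .
qed

section \<open>The iteration operator of a positive kernel\<close>

locale positive_kernel = pair_prob_space M N
  for M :: "'a measure" and N :: "'b measure" +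
  fixes k :: "'a \<Rightarrow> 'b \<Rightarrow> ennreal"
  assumes k_measurable [measurable]: "case_prod k \<in> borel_measurable (M \<Otimes>\<^sub>M N)"
    and k_pos: "x \<in> space M \<Longrightarrow> y \<in> space N \<Longrightarrow> 0 < k x y"
    and k_finite: "x \<in> space M \<Longrightarrow> y \<in> space N \<Longrightarrow> k x y < \<top>"
begin

definition K :: "('a \<Rightarrow> ennreal) \<Rightarrow> 'b \<Rightarrow> ennreal" where
  "K f y = (\<integral>\<^sup>+x. k x y * inverse (f x) \<partial>M)"

lemma k_measurable1 [measurable]: "y \<in> space N \<Longrightarrow> (\<lambda>x. k x y) \<in> borel_measurable M"
  using measurable_compose[OF measurable_Pair2' k_measurable, of y] by simp

lemma K_measurable [measurable]:
  assumes [measurable]: "f \<in> borel_measurable M"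
  shows "K f \<in> borel_measurable N"
proof -
  have "(\<lambda>(y, x). k x y) \<in> borel_measurable (N \<Otimes>\<^sub>M M)"
    using measurable_compose[OF measurable_pair_swap' k_measurable] by (simp add: case_prod_beta')
  then have "(\<lambda>(y, x). k x y * inverse (f x)) \<in> borel_measurable (N \<Otimes>\<^sub>M M)"
    by (simp add: case_prod_beta') measurable
  then show ?thesis
    unfolding K_def[abs_def] by (rule M1.borel_measurable_nn_integral)
qed

lemma K_antimono_AE: "AE x in M. f x \<le> g x \<Longrightarrow> K g y \<le> K f y"
  unfolding K_def
  by (intro nn_integral_mono_AE) (auto intro!: mult_left_mono ennreal_inverse_antimono)

lemma K_antimono: "(\<And>x. x \<in> space M \<Longrightarrow> f x \<le> g x) \<Longrightarrow> K g y \<le> K f y"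
  by (intro K_antimono_AE) auto

lemma K_cong_AE: "AE x in M. f x = g x \<Longrightarrow> K f y = K g y"
  by (intro antisym K_antimono_AE) auto

lemma K_cmult:
  assumes "0 < c" "c < \<top>" and [measurable]: "f \<in> borel_measurable M" and "y \<in> space N"
  shows "K (\<lambda>x. c * f x) y = inverse c * K f y"
proof -
  have "inverse (c * f x) = inverse c * inverse (f x)" for x
    using assms by (intro ennreal_inverse_mult') auto
  then show ?thesis
    unfolding K_def using assms by (subst nn_integral_cmult[symmetric]) (auto simp: mult_ac)
qed

text \<open>Strict monotonicity: as \<open>k x y\<close> is positive for every \<open>x\<close>,
  equality of the integrals at a single point \<open>y\<close> already determines the function
  almost everywhere.\<close>

lemma K_eq_imp_AE_eq:
  assumes [measurable]: "f \<in> borel_measurable M" "g \<in> borel_measurable M"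
    and le: "AE x in M. f x \<le> g x" and y [measurable]: "y \<in> space N"
    and eq: "K f y = K g y" and fin: "K f y < \<top>"
  shows "AE x in M. f x = g x"
proof -
  have "AE x in M. k x y * inverse (g x) = k x y * inverse (f x)"
  proof (rule nn_integral_mono_eq_imp_AE_eq)
    show "AE x in M. k x y * inverse (g x) \<le> k x y * inverse (f x)"
      using le by eventually_elim (auto intro!: mult_left_mono ennreal_inverse_antimono)
  qed (use eq fin in \<open>auto simp: K_def\<close>)
  with AE_space show ?thesis
  proof eventually_elim
    case (elim x)
    with k_pos[of x y] k_finite[of x y] y have "inverse (g x) = inverse (f x)"
      by (auto simp: ennreal_mult_cancel_left)
    then show ?case by (metis ennreal_inverse_inverse)
  qed
qed

text \<open>The right-hand side does not mention \<open>y\<close>: vanishing at one point is the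
  same as vanishing at all points.\<close>

lemma K_eq_0_iff:
  assumes [measurable]: "f \<in> borel_measurable M" and y [measurable]: "y \<in> space N"
  shows "K f y = 0 \<longleftrightarrow> (AE x in M. f x = \<top>)"
proof -
  have "K f y = 0 \<longleftrightarrow> (AE x in M. k x y * inverse (f x) = 0)"
    unfolding K_def by (intro nn_integral_0_iff_AE) auto
  also have "\<dots> \<longleftrightarrow> (AE x in M. f x = \<top>)"
    using k_pos[of _ y] y by (intro AE_cong) (fastforce simp: zero_less_iff_neq_zero)
  finally show ?thesis .
qed

lemma K_pos:
  assumes [measurable]: "f \<in> borel_measurable M" and y: "y \<in> space N"
    and "AE x in M. f x < \<top>"
  shows "0 < K f y"
proof (rule ccontr)
  assume "\<not> 0 < K f y"
  then have "AE x in M. f x = \<top>" using K_eq_0_iff[of f y] y by simp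
  with assms(3) have "AE x in M. False" by eventually_elim simp
  then show False by (simp add: M1.AE_False)
qed

text \<open>The inverse of a minimum is the maximum of the inverses, which is at most their
  sum.\<close>

lemma K_min_le:
  assumes [measurable]: "f \<in> borel_measurable M" "g \<in> borel_measurable M"
    and y [measurable]: "y \<in> space N"
  shows "K (\<lambda>x. min (f x) (g x)) y \<le> K f y + K g y"
proof -
  have "K (\<lambda>x. min (f x) (g x)) y \<le> (\<integral>\<^sup>+x. k x y * inverse (f x) + k x y * inverse (g x) \<partial>M)"
    unfolding K_def
    by (intro nn_integral_mono) (auto simp: ennreal_inverse_min distrib_left[symmetric] max_def intro!: mult_left_mono)
  also have "\<dots> = K f y + K g y"
    unfolding K_def by (intro nn_integral_add) auto
  finally show ?thesis .
qed

lemma K_INF: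
  assumes [measurable]: "\<And>n. f n \<in> borel_measurable M" and y [measurable]: "y \<in> space N"
    and dec: "\<And>x. decseq (\<lambda>n :: nat. f n x)"
  shows "K (\<lambda>x. INF n. f n x) y = (SUP n. K (f n) y)"
proof -
  have "K (\<lambda>x. INF n. f n x) y = (\<integral>\<^sup>+x. (SUP n. k x y * inverse (f n x)) \<partial>M)"
    unfolding K_def by (simp add: ennreal_inverse_INF SUP_mult_left_ennreal)
  also have "\<dots> = (SUP n. K (f n) y)"
    unfolding K_def
    by (intro nn_integral_monotone_convergence_SUP)
       (use dec in \<open>auto simp: incseq_def le_fun_def decseq_def intro!: mult_left_mono ennreal_inverse_antimono\<close>)
  finally show ?thesis .
qed

text \<open>Here the integrands decrease, so monotone convergence needs the first integral to be
  finite.\<close>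

lemma K_SUP:
  assumes [measurable]: "\<And>n. f n \<in> borel_measurable M" and y [measurable]: "y \<in> space N"
    and inc: "\<And>x. incseq (\<lambda>n :: nat. f n x)" and fin: "K (f 0) y < \<top>"
  shows "K (\<lambda>x. SUP n. f n x) y = (INF n. K (f n) y)"
proof -
  have [simp]: "k x y * (INF n. inverse (f n x)) = (INF n. k x y * inverse (f n x))"
    if "x \<in> space M" for x
    using k_pos[OF that y] k_finite[OF that y] 
    by (intro ennreal_INF_mult_left)
  have "K (\<lambda>x. SUP n. f n x) y = (\<integral>\<^sup>+x. (INF n. k x y * inverse (f n x)) \<partial>M)"
    unfolding K_def by (intro nn_integral_cong) (simp add: ennreal_inverse_SUP)
  also have "\<dots> = (INF n. K (f n) y)"
    unfolding K_def
    by (intro nn_integral_monotone_convergence_INF_AE')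
       (use inc fin in \<open>auto simp: K_def incseq_def intro!: mult_left_mono ennreal_inverse_antimono\<close>)
  finally show ?thesis .
qed

end

text \<open>The assumptions are symmetric in the two spaces, so facts about \<open>K\<close> carry
  over to \<open>dual.K\<close>, which integrates over \<open>N\<close>.\<close>

sublocale positive_kernel \<subseteq> dual: positive_kernel N M "\<lambda>y x. k x y"
proof
  show "(\<lambda>(y, x). k x y) \<in> borel_measurable (N \<Otimes>\<^sub>M M)"
    using measurable_compose[OF measurable_pair_swap' k_measurable] by (simp add: case_prod_beta')
qed (use k_pos k_finite in auto)

section \<open>The composed operator \<open>T\<close> and its integral identity\<close>

context positive_kernel
begin

abbreviation T :: "('a \<Rightarrow> ennreal) \<Rightarrow> 'a \<Rightarrow> ennreal" where
  "T f \<equiv> dual.K (K f)"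

lemma T_mono: "(\<And>x. x \<in> space M \<Longrightarrow> f x \<le> g x) \<Longrightarrow> T f x \<le> T g x"
  by (intro dual.K_antimono K_antimono)

text \<open>Both sides integrate \<open>k x y * inverse (f x) * inverse (K f y)\<close>, in the two
  orders. The right-hand integrand is 1 where \<open>K f\<close> is positive and finite, and 0
  elsewhere.\<close>

lemma nn_integral_T_ratio:
  assumes [measurable]: "f \<in> borel_measurable M"
  shows "(\<integral>\<^sup>+x. T f x * inverse (f x) \<partial>M) = (\<integral>\<^sup>+y. K f y * inverse (K f y) \<partial>N)"
proof -
  have "(\<integral>\<^sup>+x. T f x * inverse (f x) \<partial>M) =
      (\<integral>\<^sup>+x. \<integral>\<^sup>+y. k x y * inverse (K f y) * inverse (f x) \<partial>N \<partial>M)"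
    unfolding dual.K_def by (intro nn_integral_cong nn_integral_multc[symmetric]) auto
  also have "\<dots> = (\<integral>\<^sup>+y. \<integral>\<^sup>+x. k x y * inverse (K f y) * inverse (f x) \<partial>M \<partial>N)"
    by (rule Fubini'[symmetric]) (simp add: case_prod_beta')
  also have "\<dots> = (\<integral>\<^sup>+y. \<integral>\<^sup>+x. k x y * inverse (f x) * inverse (K f y) \<partial>M \<partial>N)"
    by (simp add: mult_ac)
  also have "\<dots> = (\<integral>\<^sup>+y. K f y * inverse (K f y) \<partial>N)"
    unfolding K_def[of f] by (intro nn_integral_cong nn_integral_multc) auto
  finally show ?thesis .
qed

lemma nn_integral_T_ratio_le_1:
  assumes "f \<in> borel_measurable M"
  shows "(\<integral>\<^sup>+x. T f x * inverse (f x) \<partial>M) \<le> 1"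
proof -
  have "(\<integral>\<^sup>+y. K f y * inverse (K f y) \<partial>N) \<le> (\<integral>\<^sup>+y. 1 \<partial>N)"
    by (intro nn_integral_mono ennreal_mult_inverse_le_1)
  then show ?thesis
    using assms by (simp add: nn_integral_T_ratio M2.emeasure_space_1)
qed

end

text \<open>Reopening the locale makes the preceding facts available for the transposed kernel, as \<open>dual\<close>.\<close>

context positive_kernel
begin

lemma T_pos:
  assumes [measurable]: "f \<in> borel_measurable M" and "x \<in> space M" "AE y in N. K f y < \<top>"
  shows "0 < T f x"
  using assms by (intro dual.K_pos) auto

text \<open>The dual ratio bound, applied to \<open>K f\<close>, gives
  \<open>K (T f) y * inverse (K f y)\<close> an integral of at most 1. Where \<open>K f\<close> is
  finite, a finite ratio excludes \<open>K (T f) y = \<top>\<close>.\<close>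

lemma AE_K_T_finite:
  assumes [measurable]: "f \<in> borel_measurable M" and fin: "AE y in N. K f y < \<top>"
  shows "AE y in N. K (T f) y < \<top>"
proof -
  have "(\<integral>\<^sup>+y. K (T f) y * inverse (K f y) \<partial>N) < \<infinity>"
    using dual.nn_integral_T_ratio_le_1[of "K f"] by (auto simp: le_less_trans)
  then have "AE y in N. K (T f) y * inverse (K f y) \<noteq> \<infinity>"
    by (intro nn_integral_noteq_infinite) auto
  with fin show ?thesis
    by eventually_elim (auto simp: ennreal_top_mult less_top[symmetric])
qed

section \<open>Supersolutions and subsolutions are fixed points\<close>

text \<open>The ratio of \<open>T f\<close> to \<open>f\<close> is at most 1, and its integral is
  exactly 1 because \<open>K f\<close> is positive and finite almost everywhere.\<close>

lemma T_supersolution: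
  assumes [measurable]: "f \<in> borel_measurable M"
    and f: "AE x in M. 0 < f x \<and> f x < \<top>" and fin: "AE y in N. K f y < \<top>"
    and super: "AE x in M. T f x \<le> f x"
  shows "AE x in M. T f x = f x"
proof -
  have "AE y in N. K f y * inverse (K f y) = 1"
    using fin AE_space
  proof eventually_elim
    case (elim y)
    moreover have "0 < K f y"
      using f elim by (intro K_pos) auto
    ultimately show ?case by (simp add: ennreal_mult_inverse_cancel)
  qed
  then have "(\<integral>\<^sup>+y. K f y * inverse (K f y) \<partial>N) = (\<integral>\<^sup>+y. 1 \<partial>N)"
    by (rule nn_integral_cong_AE)
  then have int: "(\<integral>\<^sup>+x. T f x * inverse (f x) \<partial>M) = 1"
    by (simp add: nn_integral_T_ratio M2.emeasure_space_1)
  have "AE x in M. T f x * inverse (f x) = 1"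
  proof (rule nn_integral_mono_eq_imp_AE_eq)
    show "AE x in M. T f x * inverse (f x) \<le> 1"
      using super f
    proof eventually_elim
      case (elim x)
      have "T f x * inverse (f x) \<le> f x * inverse (f x)"
        using elim by (intro mult_right_mono) auto
      then show ?case using elim by (simp add: ennreal_mult_inverse_cancel)
    qed
  qed (use int in \<open>auto simp: M1.emeasure_space_1\<close>)
  with f show ?thesis
    by eventually_elim (metis ennreal_mult_inverse_cancel(2) mult.assoc mult.left_neutral mult.right_neutral)
qed

text \<open>The ratio is at least 1 while its integral is at most 1. Equality in the integral bound
  also yields the finiteness of \<open>K f\<close>, which is therefore a conclusion here.\<close>

lemma T_subsolution:
  assumes [measurable]: "f \<in> borel_measurable M"
    and f: "AE x in M. 0 < f x \<and> f x < \<top>" and sub: "AE x in M. f x \<le> T f x"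
  shows "AE x in M. T f x = f x" "AE y in N. K f y < \<top>"
proof -
  have 1: "AE x in M. 1 \<le> T f x * inverse (f x)"
    using sub f
  proof eventually_elim
    case (elim x)
    have "f x * inverse (f x) \<le> T f x * inverse (f x)"
      using elim by (intro mult_right_mono) auto
    then show ?case using elim by (simp add: ennreal_mult_inverse_cancel)
  qed
  have "AE x in M. 1 = T f x * inverse (f x)"
    by (rule nn_integral_mono_eq_imp_AE_eq)
       (use 1 nn_integral_T_ratio_le_1[of f] in \<open>auto simp: M1.emeasure_space_1 le_less_trans\<close>)
  with f show "AE x in M. T f x = f x"
    by eventually_elim (metis ennreal_mult_inverse_cancel(2) mult.assoc mult.left_neutral mult.right_neutral)
  have "1 \<le> (\<integral>\<^sup>+x. T f x * inverse (f x) \<partial>M)"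
    using nn_integral_mono_AE[OF 1] by (simp add: M1.emeasure_space_1)
  then have "AE y in N. K f y * inverse (K f y) = 1"
    by (intro nn_integral_mono_eq_imp_AE_eq)
       (auto simp: nn_integral_T_ratio M2.emeasure_space_1 ennreal_mult_inverse_le_1)
  then show "AE y in N. K f y < \<top>"
    by eventually_elim (auto simp: less_top[symmetric])
qed

section \<open>Existence of a fixed point\<close>

lemma exists_T_fixpoint:
  assumes V [measurable]: "V \<in> borel_measurable M"
    and V_bounds: "\<And>x. x \<in> space M \<Longrightarrow> 0 < V x \<and> V x < \<top>"
    and KV: "\<And>y. y \<in> space N \<Longrightarrow> K V y < \<top>"
    and TV: "\<And>x. x \<in> space M \<Longrightarrow> T V x < \<top>"
    and z: "z \<in> space M" and "0 < \<epsilon>"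
    and tight: "\<And>f x. f \<in> borel_measurable M \<Longrightarrow> (\<And>x. x \<in> space M \<Longrightarrow> f x \<le> V x) \<Longrightarrow>
      T f z < \<epsilon> \<Longrightarrow> x \<in> space M \<Longrightarrow> T f x \<le> V x"
  shows "\<exists>f\<in>borel_measurable M. (AE x in M. 0 < f x \<and> f x < \<top>) \<and> (AE y in N. K f y < \<top>) \<and>
    (AE x in M. T f x = f x)"
proof -
  \<comment> \<open>The minimum with \<open>V\<close> makes the sequence decrease although
    \<open>V\<close> need not be a supersolution, and it keeps all \<open>T (F n)\<close> below the
    finite \<open>T V\<close>.\<close>
  define F where "F n = ((\<lambda>f x. min (V x) (T f x)) ^^ n) V" for n
  have F_0: "F 0 = V" and F_Suc: "F (Suc n) x = min (V x) (T (F n) x)" for n x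
    by (simp_all add: F_def)
  have F_Suc': "F (Suc n) = (\<lambda>x. min (V x) (T (F n) x))" for n
    by (simp add: fun_eq_iff F_Suc)
  have F_meas [measurable]: "F n \<in> borel_measurable M" for n
    by (induction n) (simp_all add: F_0 F_Suc')
  have F_le_V: "F n x \<le> V x" for n x
    by (cases n) (simp_all add: F_0 F_Suc)
  have F_dec: "F (Suc n) x \<le> F n x" for n x
  proof (induction n arbitrary: x)
    case (Suc n)
    have "min (V x) (T (F (Suc n)) x) \<le> min (V x) (T (F n) x)"
      by (intro min.mono order_refl T_mono Suc)
    then show ?case by (simp only: F_Suc)
  qed (simp add: F_0 F_Suc)
  have decseq_F: "decseq (\<lambda>n. F n x)" for x
    by (rule decseq_SucI) (rule F_dec)
  \<comment> \<open>Finiteness is carried along only almost everywhere: \<open>K_min_le\<close>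
    bounds \<open>K (F (Suc n))\<close> by \<open>K V\<close> plus \<open>K (T (F n))\<close>, and
    the latter is controlled by \<open>AE_K_T_finite\<close>.\<close>
  have F_K: "AE y in N. K (F n) y < \<top>" for n
  proof (induction n)
    case (Suc n)
    show ?case
      using AE_K_T_finite[OF F_meas Suc] AE_space
    proof eventually_elim
      case (elim y)
      then show ?case
        unfolding F_Suc' using KV by (intro le_less_trans[OF K_min_le]) auto
    qed
  qed (use KV in \<open>auto simp: F_0\<close>)
  have F_pos: "0 < F n x" if "x \<in> space M" for n x
    using that V_bounds F_K T_pos by (cases n) (auto simp: F_0 F_Suc)
  have F_fin: "F n x < \<top>" if "x \<in> space M" for n x
    using V_bounds[OF that] F_le_V[of n x] by (auto intro: le_less_trans)
  have TF_fin: "T (F n) x < \<top>" if "x \<in> space M" for n x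
    using TV[OF that] by (intro le_less_trans[OF T_mono[OF F_le_V]])
  show ?thesis
  proof (cases "\<exists>n. T (F n) z < \<epsilon>")
    case True
    then obtain n where n: "T (F n) z < \<epsilon>" ..
    have "T (F n) x \<le> F n x" if "x \<in> space M" for x
      using F_dec[of n x] tight[OF F_meas F_le_V n that] by (simp add: F_Suc min_absorb2)
    then have "AE x in M. T (F n) x = F n x"
      using F_K F_pos F_fin by (intro T_supersolution) auto
    with F_K F_pos F_fin show ?thesis
      by (intro bexI[of _ "F n"]) auto
  next
    case False
    define f where "f x = (INF n. F n x)" for x
    have f_meas [measurable]: "f \<in> borel_measurable M"
      unfolding f_def by measurable
    have Kf: "K f y = (SUP n. K (F n) y)" if "y \<in> space N" for y
      unfolding f_def using that decseq_F by (intro K_INF) auto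
    \<comment> \<open>\<open>K (F n)\<close> increases and \<open>T (F n)\<close> decreases;
      finiteness of \<open>T (F 0)\<close> allows the second passage to the limit.\<close>
    have Tf: "T f x = (INF n. T (F n) x)" if "x \<in> space M" for x
    proof -
      have "T f x = dual.K (\<lambda>y. SUP n. K (F n) y) x"
        using Kf by (intro dual.K_cong_AE) auto
      also have "\<dots> = (INF n. T (F n) x)"
        using that TF_fin F_dec
        by (intro dual.K_SUP) (auto intro!: incseq_SucI K_antimono)
      finally show ?thesis .
    qed
    have f_le: "f x \<le> T f x" if "x \<in> space M" for x
      unfolding Tf[OF that] f_def by (intro INF_mono) (metis F_Suc UNIV_I min.cobounded2)
    have f_eq: "f x \<ge> min (V x) (T f x)" if "x \<in> space M" for x
      unfolding Tf[OF that] f_def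
    proof (intro INF_greatest)
      fix n
      have "min (V x) (\<Sqinter>n. T (F n) x) \<le> F (Suc n) x"
        by (auto simp: F_Suc intro: min.coboundedI2 INF_lower)
      also have "\<dots> \<le> F n x" by (rule F_dec)
      finally show "min (V x) (\<Sqinter>n. T (F n) x) \<le> F n x" .
    qed
    \<comment> \<open>Positivity at \<open>z\<close> spreads to all points, since the criterion for
      \<open>dual.K\<close> to vanish is independent of the point. With \<open>f_eq\<close> it then
      passes to \<open>f\<close>.\<close>
    have "\<epsilon> \<le> T f z"
      unfolding Tf[OF z] using False by (intro INF_greatest) (auto simp: not_less)
    then have "\<not> (AE y in N. K f y = \<top>)"
      using dual.K_eq_0_iff[of "K f" z] z \<open>0 < \<epsilon>\<close> by auto
    then have Tf_pos: "0 < T f x" if "x \<in> space M" for x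
      using dual.K_eq_0_iff[of "K f" x] that by (auto simp: zero_less_iff_neq_zero)
    have f_pos: "0 < f x" if "x \<in> space M" for x
      using Tf_pos[OF that] V_bounds[OF that] by (intro less_le_trans[OF _ f_eq[OF that]]) simp
    have f_fin: "f x < \<top>" if "x \<in> space M" for x
      unfolding f_def using F_fin[OF that, of 0] by (rule le_less_trans[OF INF_lower, rotated]) auto
    have "AE x in M. T f x = f x" "AE y in N. K f y < \<top>"
      by (rule T_subsolution; use f_pos f_fin f_le in auto)+
    with f_pos f_fin show ?thesis
      by (intro bexI[of _ f]) auto
  qed
qed

section \<open>Uniqueness of the fixed point up to scaling\<close>

lemma T_fixpoints_comparable:
  assumes [measurable]: "f \<in> borel_measurable M" "g \<in> borel_measurable M"
    and f: "AE x in M. 0 < f x \<and> f x < \<top>" "AE y in N. K f y < \<top>" "AE x in M. T f x = f x"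
    and g: "AE x in M. 0 < g x \<and> g x < \<top>" "AE y in N. K g y < \<top>" "AE x in M. T g x = g x"
  shows "(AE x in M. f x \<le> g x) \<or> (AE x in M. g x \<le> f x)"
proof -
  define h where "h x = min (f x) (g x)" for x
  have h_le: "h x \<le> f x" "h x \<le> g x" for x
    by (simp_all add: h_def)
  have h_meas [measurable]: "h \<in> borel_measurable M"
    unfolding h_def by measurable
  have h_bounds: "AE x in M. 0 < h x \<and> h x < \<top>"
    using f(1) g(1) by eventually_elim (auto simp: h_def min_def)
  have Kh: "AE y in N. K h y < \<top>"
    using f(2) g(2) AE_space
    by eventually_elim (auto simp: h_def[abs_def] intro!: le_less_trans[OF K_min_le])
  \<comment> \<open>Interposed to give \<open>T h x \<le> dual.K m x \<le> h x\<close> almost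
    everywhere. Once \<open>T h = h\<close>, both are equalities, and strict monotonicity of
    \<open>dual.K\<close> yields \<open>m = K h\<close> almost everywhere.\<close>
  define m where "m y = max (K f y) (K g y)" for y
  have m_meas [measurable]: "m \<in> borel_measurable N"
    unfolding m_def by measurable
  have m_le: "m y \<le> K h y" for y
    by (auto simp: m_def h_def intro!: K_antimono)
  have Th_le: "T h x \<le> dual.K m x" for x
    by (intro dual.K_antimono m_le)
  have Km_le: "AE x in M. dual.K m x \<le> h x"
    using f(3) g(3)
  proof eventually_elim
    case (elim x)
    have "dual.K m x \<le> T f x" "dual.K m x \<le> T g x"
      by (auto simp: m_def intro!: dual.K_antimono)
    then show ?case using elim by (simp add: h_def)
  qed
  have "AE x in M. T h x = h x"
    using Km_le by (intro T_supersolution h_bounds Kh h_meas) (auto elim!: eventually_mono intro: order_trans[OF Th_le])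
  with Km_le h_bounds AE_space have "AE x in M. x \<in> space M \<and> dual.K m x = T h x \<and> T h x < \<top>"
  proof eventually_elim
    case (elim x)
    then show ?case using Th_le[of x] by auto
  qed
  from eventually_happens'[OF M1.ae_filter_bot this]
  obtain x where x: "x \<in> space M" "dual.K m x = T h x" "T h x < \<top>" by auto
  then have "AE y in N. m y = K h y"
    by (intro dual.K_eq_imp_AE_eq[where y = x]) (auto simp: m_le)
  with Kh AE_space have "AE y in N. y \<in> space N \<and> m y = K h y \<and> K h y < \<top>"
    by eventually_elim auto
  from eventually_happens'[OF M2.ae_filter_bot this]
  obtain y where y: "y \<in> space N" "m y = K h y" "K h y < \<top>" by auto
  \<comment> \<open>One point \<open>y\<close> decides: there \<open>K h y\<close> equals
    \<open>K f y\<close> or \<open>K g y\<close>, and strict monotonicity of \<open>K\<close>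
    identifies \<open>h\<close> with \<open>f\<close> or \<open>g\<close>.\<close>
  show ?thesis
  proof (cases "K f y \<ge> K g y")
    case True
    with y have "AE x in M. h x = f x"
      by (intro K_eq_imp_AE_eq[where y = y]) (auto simp: m_def h_le max_def)
    then have "AE x in M. f x \<le> g x" by eventually_elim (metis h_le)
    then show ?thesis ..
  next
    case False
    with y have "AE x in M. h x = g x"
      by (intro K_eq_imp_AE_eq[where y = y]) (auto simp: m_def h_le max_def split: if_splits)
    then have "AE x in M. g x \<le> f x" by eventually_elim (metis h_le)
    then show ?thesis ..
  qed
qed

lemma T_cmult:
  assumes [measurable]: "f \<in> borel_measurable M" and c: "0 < c" "c < \<top>" and "x \<in> space M"
  shows "T (\<lambda>x. c * f x) x = c * T f x"
proof -
  have "T (\<lambda>x. c * f x) x = dual.K (\<lambda>y. inverse c * K f y) x"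
    using c by (intro dual.K_cong_AE) (auto simp: K_cmult)
  also have "\<dots> = c * T f x"
    using assms by (subst dual.K_cmult) (auto simp: ennreal_inverse_inverse less_top[symmetric] ennreal_inverse_positive zero_less_iff_neq_zero)
  finally show ?thesis .
qed

text \<open>Comparing \<open>g\<close> with the fixed point \<open>l * f\<close> for each
  \<open>l > 0\<close> shows that every level \<open>l\<close> is an almost sure upper or lower
  bound of the quotient \<open>u\<close>.\<close>

lemma T_fixpoint_unique:
  assumes [measurable]: "f \<in> borel_measurable M" "g \<in> borel_measurable M"
    and f: "AE x in M. 0 < f x \<and> f x < \<top>" "AE y in N. K f y < \<top>" "AE x in M. T f x = f x"
    and g: "AE x in M. 0 < g x \<and> g x < \<top>" "AE y in N. K g y < \<top>" "AE x in M. T g x = g x"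
  shows "\<exists>c::real. c > 0 \<and> (AE x in M. g x = ennreal c * f x)"
proof -
  define u where "u x = enn2real (g x) / enn2real (f x)" for x
  have u: "AE x in M. 0 < u x \<and> g x = ennreal (u x) * f x"
    using f(1) g(1)
  proof eventually_elim
    case (elim x)
    then show ?case
      by (cases "f x"; cases "g x") (auto simp: u_def ennreal_mult[symmetric] zero_less_iff_neq_zero)
  qed
  have comp: "(AE x in M. u x \<le> l) \<or> (AE x in M. l \<le> u x)" for l
  proof (cases "l > 0")
    case True
    have "(AE x in M. g x \<le> ennreal l * f x) \<or> (AE x in M. ennreal l * f x \<le> g x)"
    proof (rule T_fixpoints_comparable[OF _ _ g])
      show "AE x in M. 0 < ennreal l * f x \<and> ennreal l * f x < \<top>"
        using f(1) by eventually_elim (use True in \<open>auto simp: ennreal_zero_less_mult_iff ennreal_mult_less_top\<close>)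
      show "AE y in N. K (\<lambda>x. ennreal l * f x) y < \<top>"
        using f(2) AE_space
        by eventually_elim (use True in \<open>auto simp: K_cmult ennreal_mult_less_top inverse_ennreal\<close>)
      show "AE x in M. T (\<lambda>x. ennreal l * f x) x = ennreal l * f x"
        using f(3) AE_space
        by eventually_elim (use True in \<open>auto simp: T_cmult\<close>)
    qed auto
    moreover have *: "AE x in M. (g x \<le> ennreal l * f x \<longrightarrow> u x \<le> l) \<and> (ennreal l * f x \<le> g x \<longrightarrow> l \<le> u x)"
      using u f(1)
    proof eventually_elim
      case (elim x)
      then show ?case
        using True by (cases "f x") (auto simp: ennreal_mult[symmetric])
    qed
    ultimately show ?thesis
    proof (elim disjE)
      assume "AE x in M. g x \<le> ennreal l * f x"
      with * have "AE x in M. u x \<le> l" by eventually_elim auto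
      then show ?thesis ..
    next
      assume "AE x in M. ennreal l * f x \<le> g x"
      with * have "AE x in M. l \<le> u x" by eventually_elim auto
      then show ?thesis ..
    qed
  next
    case False
    have "AE x in M. l \<le> u x"
      using u by eventually_elim (use False in auto)
    then show ?thesis ..
  qed
  obtain c where c: "AE x in M. u x = c"
    using AE_eq_const_of_AE_linear[OF M1.ae_filter_bot comp] by auto
  with u have "AE x in M. c > 0 \<and> g x = ennreal c * f x"
    by eventually_elim auto
  then show ?thesis by (auto simp: M1.AE_False intro!: exI[of _ c])
qed
end

section \<open>Solutions of the Schroedinger system as fixed points\<close>

context positive_kernel
begin

text \<open>Stating the system for the locale kernel gives its transposed form as
  \<open>dual.solves\<close>.\<close>

definition solves :: "'a measure \<Rightarrow> 'b measure \<Rightarrow> bool" where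
  "solves a b \<longleftrightarrow>
     sets a = sets M \<and> sigma_finite_measure a \<and>
     sets b = sets N \<and> sigma_finite_measure b \<and>
     density a (\<lambda>x. \<integral>\<^sup>+ y. k x y \<partial>b) = M \<and>
     density b (\<lambda>y. \<integral>\<^sup>+ x. k x y \<partial>a) = N"

lemma nn_integral_density_inverse:
  assumes [measurable]: "f \<in> borel_measurable M" and [measurable]: "y \<in> space N"
  shows "(\<integral>\<^sup>+ x. k x y \<partial>density M (\<lambda>x. inverse (f x))) = K f y"
  by (simp add: nn_integral_density K_def mult.commute)

lemma density_density_inverse:
  assumes [measurable]: "f \<in> borel_measurable M" "g \<in> borel_measurable M"
    and f: "AE x in M. 0 < f x \<and> f x < \<top>" and g: "AE x in M. g x = f x"
  shows "density (density M (\<lambda>x. inverse (f x))) g = M"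
proof -
  have "density (density M (\<lambda>x. inverse (f x))) g = density M (\<lambda>x. inverse (f x) * g x)"
    by (rule density_density_eq) auto
  also have "\<dots> = density M (\<lambda>_. 1)"
  proof (rule density_cong)
    show "AE x in M. inverse (f x) * g x = 1"
      using f g by eventually_elim (simp add: ennreal_mult_inverse_cancel)
  qed auto
  finally show ?thesis by (simp add: density_1)
qed

lemma sigma_finite_density_inverse:
  assumes [measurable]: "f \<in> borel_measurable M" and f: "AE x in M. 0 < f x"
  shows "sigma_finite_measure (density M (\<lambda>x. inverse (f x)))"
  using f by (subst M1.sigma_finite_iff_density_finite) (auto elim!: eventually_mono)

end

context positive_kernel
begin

text \<open>Integrating the kernel against \<open>?b\<close> gives \<open>T f\<close>, so the first
  equation is the fixed point property; against \<open>?a\<close> it gives \<open>K f\<close>, which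
  cancels the density of \<open>?b\<close>.\<close>

lemma solves_of_T_fixpoint:
  assumes [measurable]: "f \<in> borel_measurable M"
    and f: "AE x in M. 0 < f x \<and> f x < \<top>" "AE y in N. K f y < \<top>" "AE x in M. T f x = f x"
  shows "solves (density M (\<lambda>x. inverse (f x))) (density N (\<lambda>y. inverse (K f y)))"
    (is "solves ?a ?b")
proof -
  have Kf: "AE y in N. 0 < K f y \<and> K f y < \<top>"
    using f(2) AE_space
  proof eventually_elim
    case (elim y)
    moreover have "0 < K f y"
      using f(1) elim by (intro K_pos) auto
    ultimately show ?case by simp
  qed
  have "density ?a (\<lambda>x. \<integral>\<^sup>+ y. k x y \<partial>?b) = density ?a (T f)"
    by (intro density_cong_space) (simp add: dual.nn_integral_density_inverse)
  also have "\<dots> = M"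
    using f by (intro density_density_inverse) auto
  finally have 1: "density ?a (\<lambda>x. \<integral>\<^sup>+ y. k x y \<partial>?b) = M" .
  have "density ?b (\<lambda>y. \<integral>\<^sup>+ x. k x y \<partial>?a) = density ?b (K f)"
    by (intro density_cong_space) (simp add: nn_integral_density_inverse)
  also have "\<dots> = N"
    using Kf by (intro dual.density_density_inverse) auto
  finally show ?thesis
    using 1 f Kf unfolding solves_def
    by (auto intro!: sigma_finite_density_inverse dual.sigma_finite_density_inverse elim!: eventually_mono)
qed

text \<open>As the kernel is positive, a vanishing integral would make \<open>b\<close> the null
  measure, and no density of it could be the probability measure \<open>N\<close>.\<close>

lemma solves_imp_pos:
  assumes ab: "solves a b" and x: "x \<in> space M"
  shows "0 < (\<integral>\<^sup>+ y. k x y \<partial>b)"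
proof (rule ccontr)
  have [measurable_cong]: "sets b = sets N" "sets a = sets M" 
    and sf: "sigma_finite_measure a" using ab by (auto simp: solves_def)
  note [measurable] = x
  have sp: "space b = space N" using ab by (auto simp: solves_def intro: sets_eq_imp_space_eq)
  assume "\<not> 0 < (\<integral>\<^sup>+ y. k x y \<partial>b)"
  then have "AE y in b. k x y = 0"
    by (subst nn_integral_0_iff_AE[symmetric]) (auto simp: dual.k_measurable1 cong: measurable_cong_sets)
  with AE_space have False_ae: "AE y in b. False"
    by eventually_elim (use k_pos[OF x] sp in \<open>metis less_irrefl\<close>)
  interpret a: sigma_finite_measure a by fact
  have "AE y in density b (\<lambda>y. \<integral>\<^sup>+ x. k x y \<partial>a). False"
    using False_ae by (subst AE_density) (auto elim!: eventually_mono)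
  moreover have "density b (\<lambda>y. \<integral>\<^sup>+ x. k x y \<partial>a) = N"
    using ab by (simp add: solves_def)
  ultimately have "AE y in N. False" by (simp only:)
  then show False by (simp add: M2.AE_False)
qed

lemma solves_dual: "dual.solves b a \<longleftrightarrow> solves a b"
  by (auto simp: solves_def dual.solves_def)

end

context positive_kernel
begin

text \<open>Take \<open>f\<close> and \<open>g\<close> to be the two kernel integrals in the system.
  Its equations say that \<open>a\<close> is \<open>M\<close> divided by \<open>f\<close> and
  \<open>b\<close> is \<open>N\<close> divided by \<open>g\<close>; substituting back gives
  \<open>g = K f\<close> and \<open>f = dual.K g\<close>.\<close>

lemma T_fixpoint_of_solves:
  assumes ab: "solves a b"
  obtains f where "f \<in> borel_measurable M"
    "AE x in M. 0 < f x \<and> f x < \<top>" "AE y in N. K f y < \<top>" "AE x in M. T f x = f x"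
    "a = density M (\<lambda>x. inverse (f x))" "b = density N (\<lambda>y. inverse (K f y))"
proof -
  have sets [measurable_cong]: "sets a = sets M" "sets b = sets N"
    using ab by (auto simp: solves_def)
  interpret a: sigma_finite_measure a using ab by (simp add: solves_def)
  interpret b: sigma_finite_measure b using ab by (simp add: solves_def)
  note sp = sets_eq_imp_space_eq[OF sets(1)] sets_eq_imp_space_eq[OF sets(2)]
  define f where "f x = (\<integral>\<^sup>+ y. k x y \<partial>b)" for x
  define g where "g y = (\<integral>\<^sup>+ x. k x y \<partial>a)" for y
  have f_meas [measurable]: "f \<in> borel_measurable M"
    unfolding f_def by measurable
  have g_meas [measurable]: "g \<in> borel_measurable N"
    unfolding g_def by measurable
  have f_pos: "0 < f x" if "x \<in> space M" for x
    unfolding f_def by (rule solves_imp_pos[OF ab that])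
  have g_pos: "0 < g y" if "y \<in> space N" for y
    unfolding g_def using dual.solves_imp_pos[of b a y] ab that by (simp add: solves_dual)
  have eq: "density a f = M" "density b g = N"
    using ab by (simp_all add: solves_def f_def[abs_def] g_def[abs_def])
  note a = density_eq_prob_imp_eq_density_inverse[OF M1.prob_space_axioms eq(1)]
  note b = density_eq_prob_imp_eq_density_inverse[OF M2.prob_space_axioms eq(2)]
  have f_fin: "AE x in M. f x < \<top>" and a_eq: "a = density M (\<lambda>x. inverse (f x))"
    using a f_pos by (auto simp: sp)
  have g_fin: "AE x in N. g x < \<top>" and b_eq: "b = density N (\<lambda>y. inverse (g y))"
    using b g_pos by (auto simp: sp)
  have g_K: "g y = K f y" if "y \<in> space N" for y
    unfolding g_def a_eq using that by (simp add: nn_integral_density_inverse)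
  have f_K: "f x = dual.K g x" if "x \<in> space M" for x
    unfolding f_def b_eq using that by (simp add: dual.nn_integral_density_inverse)
  show thesis
  proof (rule that[of f])
    show "AE x in M. T f x = f x"
      using g_K by (auto simp: f_K intro!: dual.K_cong_AE)
    show "AE y in N. K f y < \<top>"
      using g_fin AE_space by eventually_elim (simp add: g_K)
    show "b = density N (\<lambda>y. inverse (K f y))"
      unfolding b_eq using g_K by (intro density_cong) auto
  qed (use f_fin f_pos a_eq in \<open>auto elim!: eventually_mono\<close>)
qed

text \<open>If \<open>g = c * f\<close> almost everywhere, then \<open>K g\<close> is
  \<open>K f\<close> divided by \<open>c\<close>; hence the opposite scalings of the two
  measures.\<close>

lemma solves_unique:
  assumes "solves a b" "solves a' b'"
  shows "\<exists>c::real. c > 0 \<and> a' = scale_measure (ennreal (inverse c)) a \<and> b' = scale_measure (ennreal c) b"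
proof -
  obtain f where f [measurable]: "f \<in> borel_measurable M"
    and f_props: "AE x in M. 0 < f x \<and> f x < \<top>" "AE y in N. K f y < \<top>" "AE x in M. T f x = f x"
    and ab: "a = density M (\<lambda>x. inverse (f x))" "b = density N (\<lambda>y. inverse (K f y))"
    using assms(1) by (rule T_fixpoint_of_solves)
  obtain g where g [measurable]: "g \<in> borel_measurable M"
    and g_props: "AE x in M. 0 < g x \<and> g x < \<top>" "AE y in N. K g y < \<top>" "AE x in M. T g x = g x"
    and ab': "a' = density M (\<lambda>x. inverse (g x))" "b' = density N (\<lambda>y. inverse (K g y))"
    using assms(2) by (rule T_fixpoint_of_solves)
  obtain c :: real where c: "c > 0" and eq: "AE x in M. g x = ennreal c * f x"
    using T_fixpoint_unique[OF f g f_props g_props] by auto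
  have "a' = density M (\<lambda>x. ennreal (inverse c) * inverse (f x))"
    unfolding ab'
  proof (rule density_cong)
    show "AE x in M. inverse (g x) = ennreal (inverse c) * inverse (f x)"
      using eq by eventually_elim (use c in \<open>simp add: ennreal_inverse_mult' inverse_ennreal\<close>)
  qed auto
  moreover have "b' = density N (\<lambda>y. ennreal c * inverse (K f y))"
    unfolding ab'
  proof (intro density_cong AE_I2)
    fix y assume "y \<in> space N"
    then have "K g y = ennreal (inverse c) * K f y"
      using c eq by (subst K_cong_AE[OF eq]) (simp add: K_cmult inverse_ennreal)
    then show "inverse (K g y) = ennreal c * inverse (K f y)"
      using c by (simp add: ennreal_inverse_mult' inverse_ennreal)
  qed auto
  ultimately show ?thesis
    using c by (intro exI[of _ c]) (auto simp: ab scale_measure_density)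
qed

end

section \<open>Condition (iii) and the conclusion for the Schroedinger system\<close>

theorem proposition1p12:
  fixes \<mu> :: "'a measure" and \<nu> :: "'b measure"
    and p :: "'a \<times> 'b \<Rightarrow> real" and U :: "'a \<Rightarrow> real"
  assumes "prob_space \<mu>" and "prob_space \<nu>"
    and p_measurable: "p \<in> borel_measurable (\<mu> \<Otimes>\<^sub>M \<nu>)"
    and p_pos: "\<And>x y. x \<in> space \<mu> \<Longrightarrow> y \<in> space \<nu> \<Longrightarrow> p (x, y) > 0"
    and U_measurable: "U \<in> borel_measurable \<mu>"
    and U_pos: "\<And>x. x \<in> space \<mu> \<Longrightarrow> U x > 0"
    and i: "\<And>y. y \<in> space \<nu> \<Longrightarrow> schroedinger_Psi \<mu> p U y < \<infinity>"
    and ii: "\<And>x. x \<in> space \<mu> \<Longrightarrow> schroedinger_Phi \<mu> \<nu> p U x < \<infinity>"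
    and iii: "\<And>x\<^sub>o. x\<^sub>o \<in> space \<mu> \<Longrightarrow>
      \<exists>r c :: real. r > 1 \<and> c > 0 \<and>
        (\<forall>x\<in>space \<mu>.
          (\<integral>\<^sup>+ y. ennreal ((p (x, y) / p (x\<^sub>o, y)) powr r * p (x\<^sub>o, y))
                   * inverse (schroedinger_Psi \<mu> p U y) \<partial>\<nu>)
          \<le> ennreal (c * U x powr r))"
  shows "(\<exists>a b. schroedinger_solution \<mu> \<nu> p a b) \<and>
    (\<forall>a b a' b'. schroedinger_solution \<mu> \<nu> p a b \<longrightarrow> schroedinger_solution \<mu> \<nu> p a' b' \<longrightarrow>
      (\<exists>\<kappa>::real. \<kappa> > 0 \<and>
        a' = scale_measure (ennreal (inverse \<kappa>)) a \<and> b' = scale_measure (ennreal \<kappa>) b))"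
proof -
  define k where "k x y = ennreal (p (x, y))" for x y
  define V where "V x = ennreal (U x)" for x
  note [measurable] = p_measurable U_measurable
  interpret positive_kernel \<mu> \<nu> k
  proof (intro positive_kernel.intro pair_prob_space.intro pair_sigma_finite.intro positive_kernel_axioms.intro
      prob_space_imp_sigma_finite assms(1,2))
    show "case_prod k \<in> borel_measurable (\<mu> \<Otimes>\<^sub>M \<nu>)"
      by (simp add: k_def[abs_def])
  qed (use p_pos in \<open>auto simp: k_def\<close>)
  have V_meas [measurable]: "V \<in> borel_measurable \<mu>"
    unfolding V_def by measurable
  have Psi: "schroedinger_Psi \<mu> p U y = K V y" if "y \<in> space \<nu>" for y
    unfolding schroedinger_Psi_def K_def using that U_pos p_pos
    by (intro nn_integral_cong) (simp add: V_def k_def inverse_ennreal ennreal_mult less_imp_le)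
  have Phi: "schroedinger_Phi \<mu> \<nu> p U x = T V x" if "x \<in> space \<mu>" for x
    unfolding schroedinger_Phi_def dual.K_def using that
    by (intro nn_integral_cong) (simp add: k_def Psi)
  have solution: "schroedinger_solution \<mu> \<nu> p a b \<longleftrightarrow> solves a b" for a b
    by (simp add: schroedinger_solution_def solves_def k_def)
  obtain z where z: "z \<in> space \<mu>"
    using M1.not_empty by auto
  obtain r c :: real where "r > 1" "c > 0" and
    rc: "\<And>x. x \<in> space \<mu> \<Longrightarrow> (\<integral>\<^sup>+ y. ennreal ((p (x, y) / p (z, y)) powr r * p (z, y))
                   * inverse (schroedinger_Psi \<mu> p U y) \<partial>\<nu>) \<le> ennreal (c * U x powr r)"
    using iii[OF z] by auto
  \<comment> \<open>Chosen so that \<open>c * L powr (1 - r) = 1 / 2\<close>. With the threshold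
    \<open>1 / (2 * L)\<close> for \<open>T f z\<close>, the parts below and above the truncation
    level contribute at most \<open>U x / 2\<close> each.\<close>
  define L where "L = (2 * c) powr (1 / (r - 1))"
  have "L > 0"
    using \<open>c > 0\<close> by (simp add: L_def)
  have L_powr: "c * L powr (1 - r) = 1 / 2"
  proof -
    have "1 / (r - 1) * (1 - r) = - 1"
      using \<open>r > 1\<close> by (simp add: divide_simps)
    then have "L powr (1 - r) = (2 * c) powr (- 1)"
      unfolding L_def powr_powr by simp
    then show ?thesis using \<open>c > 0\<close> by (simp add: powr_minus field_simps)
  qed
  have tight: "T f x \<le> V x"
    if [measurable]: "f \<in> borel_measurable \<mu>" and f_le: "\<And>x. x \<in> space \<mu> \<Longrightarrow> f x \<le> V x"
      and small: "T f z < ennreal (1 / (2 * L))" and x: "x \<in> space \<mu>" for f x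
  proof -
    note [measurable] = x z
    let ?t = "L * U x"
    have "?t > 0" using \<open>L > 0\<close> U_pos[OF x] by simp
    let ?q = "\<lambda>y. ennreal ((p (x, y) / p (z, y)) powr r * p (z, y))"
    \<comment> \<open>Truncating \<open>p (x, y) / p (z, y)\<close> at the level \<open>L * U x\<close> replaces the Hoelder inequality.\<close>
    have split: "k x y * inverse (K f y) \<le> ennreal ?t * (k z y * inverse (K f y))
        + ennreal (?t powr (1 - r)) * (?q y * inverse (K V y))"
      (is "_ \<le> ?A + ?B") if y: "y \<in> space \<nu>" for y
    proof (cases "p (x, y) \<le> ?t * p (z, y)")
      case True
      then have "k x y \<le> ennreal ?t * k z y"
        using p_pos[OF z y] \<open>?t > 0\<close> by (simp add: k_def ennreal_mult[symmetric])
      then have "k x y * inverse (K f y) \<le> ?A"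
        unfolding mult.assoc[symmetric] by (rule mult_right_mono) simp
      then show ?thesis by (rule order_trans) simp
    next
      case False
      let ?s = "p (x, y) / p (z, y)"
      have "?s \<le> ?t powr (1 - r) * ?s powr r"
        using False p_pos[OF z y] \<open>?t > 0\<close> \<open>r > 1\<close>
        by (intro le_powr_mult_powr) (auto simp: field_simps)
      then have "p (x, y) \<le> ?t powr (1 - r) * (?s powr r * p (z, y))"
        using p_pos[OF z y] by (simp add: field_simps)
      then have "k x y \<le> ennreal (?t powr (1 - r)) * ?q y"
        using p_pos[OF z y] \<open>?t > 0\<close> by (simp add: k_def ennreal_mult[symmetric])
      \<comment> \<open>Since \<open>f \<le> V\<close>, \<open>K f\<close> dominates
        \<open>K V\<close>, which is the weight occurring in condition (iii).\<close>
      then have "k x y * inverse (K f y) \<le> ennreal (?t powr (1 - r)) * ?q y * inverse (K V y)"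
        using f_le by (intro mult_mono ennreal_inverse_antimono K_antimono) auto
      then show ?thesis
        unfolding mult.assoc by (rule order_trans) simp
    qed
    have "T f x \<le> (\<integral>\<^sup>+ y. ennreal ?t * (k z y * inverse (K f y))
        + ennreal (?t powr (1 - r)) * (?q y * inverse (K V y)) \<partial>\<nu>)"
      unfolding dual.K_def by (intro nn_integral_mono split)
    also have "\<dots> = ennreal ?t * T f z
        + ennreal (?t powr (1 - r)) * (\<integral>\<^sup>+ y. ?q y * inverse (K V y) \<partial>\<nu>)"
      by (simp add: nn_integral_add nn_integral_cmult dual.K_def)
    also have "(\<integral>\<^sup>+ y. ?q y * inverse (K V y) \<partial>\<nu>)
        = (\<integral>\<^sup>+ y. ?q y * inverse (schroedinger_Psi \<mu> p U y) \<partial>\<nu>)"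
      by (intro nn_integral_cong) (simp add: Psi)
    also have "ennreal ?t * T f z + ennreal (?t powr (1 - r)) * \<dots>
        \<le> ennreal ?t * ennreal (1 / (2 * L)) + ennreal (?t powr (1 - r)) * ennreal (c * U x powr r)"
      using small rc[OF x] by (intro add_mono mult_left_mono) auto
    also have "\<dots> = ennreal (?t * (1 / (2 * L)) + ?t powr (1 - r) * (c * U x powr r))"
      using \<open>L > 0\<close> \<open>c > 0\<close> U_pos[OF x] by (simp add: ennreal_mult[symmetric] ennreal_plus[symmetric] del: ennreal_plus)
    also have "?t powr (1 - r) * (c * U x powr r) = (c * L powr (1 - r)) * (U x powr (1 - r) * U x powr r)"
      using \<open>L > 0\<close> U_pos[OF x] by (simp add: powr_mult)
    also have "\<dots> = U x / 2"
      using U_pos[OF x] by (simp add: L_powr powr_add[symmetric])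
    also have "?t * (1 / (2 * L)) + U x / 2 = U x"
      using \<open>L > 0\<close> by simp
    finally show ?thesis by (simp add: V_def)
  qed
  have "\<exists>f\<in>borel_measurable \<mu>. (AE x in \<mu>. 0 < f x \<and> f x < \<top>) \<and> (AE y in \<nu>. K f y < \<top>) \<and>
      (AE x in \<mu>. T f x = f x)"
  proof (rule exists_T_fixpoint[OF V_meas _ _ _ z])
    show "0 < ennreal (1 / (2 * L))"
      using \<open>L > 0\<close> by simp
    show "K V y < \<top>" if "y \<in> space \<nu>" for y
      using i[OF that] Psi[OF that] by simp
    show "T V x < \<top>" if "x \<in> space \<mu>" for x
      using ii[OF that] Phi[OF that] by simp
  qed (use U_pos in \<open>auto simp: V_def intro!: tight[unfolded V_def]\<close>)
  then have "\<exists>a b. solves a b"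
    using solves_of_T_fixpoint by blast
  then show ?thesis
    using solves_unique unfolding solution by blast
qed

end
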